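(* Let $\mathbb{K}$ be a field with $\mathrm{char}(\mathbb{K})\neq 2$ and let $\mathfrak{a}=\mathfrak{a}(\mathfrak{g};\kappa,\lambda,s)$ be a Lie affgebra over $\mathbb{K}$. If $\kappa=2\lambda$, $[x,\lambda(y)]=0$ for all $x,y\in\mathfrak{a}$, and $\mathrm{ad}_s=0$, then the center $\mathfrak{Z}(\mathfrak{a})$ is an ideaf of $\mathfrak{a}$.
   Context: For a Lie algebra $(\mathfrak{g},[-,-])$ over $\mathbb{K}$, linear maps $\kappa,\lambda:\mathfrak{g}\to\mathfrak{g}$ with $\lambda([a,b])=[\lambda(a),b]+[a,\lambda(b)]-[a,\kappa(b)]$ for all $a,b\in\mathfrak{g}$, and $s\in\mathfrak{g}$, the Lie affgebra $\mathfrak{a}(\mathfrak{g};\kappa,\lambda,s)$ is the set $\mathfrak{g}$ with its affine space structure $\langle a,b,c\rangle=a-b+c$, $\alpha\triangleright_a b=(1-\alpha)a+\alpha b$, and the affine Lie bracket $\{a,b\}=[a,b]+\kappa(a)+\lambda(b-a)+s$. Here $\mathrm{ad}_s(x)=[s,x]$. The center of $\mathfrak{a}$ is $\mathfrak{Z}(\mathfrak{a})=\{b\in\mathfrak{a}\mid\{a,b\}=\{b,a\}\ \text{for all } a\in\mathfrak{a}\}$. An ideaf of $\mathfrak{a}$ is a (non-empty) affine subspace $\mathfrak{b}\subseteq\mathfrak{a}$ such that $\{a,b\}\in\mathfrak{b}$ and $\{b,a\}\in\mathfrak{b}$ for all $a\in\mathfrak{a}$, $b\in\mathfrak{b}$.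 *)

theory Defs
  imports Complex_Main
begin

locale lie_algebra = vector_space scale
  for scale :: "'k::field \<Rightarrow> 'g::ab_group_add \<Rightarrow> 'g" +
  fixes lie :: "'g \<Rightarrow> 'g \<Rightarrow> 'g"
  assumes lie_linear_left: "Vector_Spaces.linear scale scale (\<lambda>x. lie x y)"
    and lie_linear_right: "Vector_Spaces.linear scale scale (\<lambda>y. lie x y)"
    and lie_alternating: "lie x x = 0"
    and lie_jacobi: "lie x (lie y z) + lie y (lie z x) + lie z (lie x y) = 0"

definition ad :: "('g \<Rightarrow> 'g \<Rightarrow> 'g) \<Rightarrow> 'g \<Rightarrow> 'g \<Rightarrow> 'g" where
  "ad lie s = (\<lambda>x. lie s x)"

locale lie_affgebra_data = lie_algebra scale lie
  for scale :: "'k::field \<Rightarrow> 'g::ab_group_add \<Rightarrow> 'g"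
    and lie :: "'g \<Rightarrow> 'g \<Rightarrow> 'g" +
  fixes \<kappa> lam :: "'g \<Rightarrow> 'g"
  assumes kappa_linear: "Vector_Spaces.linear scale scale \<kappa>"
    and lam_linear: "Vector_Spaces.linear scale scale lam"
    and lam_lie: "lam (lie a b) = lie (lam a) b + lie a (lam b) - lie a (\<kappa> b)"

text \<open>
  The operations of an affgebra whose underlying set is the whole type:
  \<open>tern A a b c\<close> is $\langle a,b,c\rangle$,
  \<open>act A \<alpha> a b\<close> is $\alpha\triangleright_a b$,
  and \<open>aff_lie A a b\<close> is $\{a,b\}$.
\<close>

record ('k, 'g) affgebra =
  tern :: "'g \<Rightarrow> 'g \<Rightarrow> 'g \<Rightarrow> 'g"
  act :: "'k \<Rightarrow> 'g \<Rightarrow> 'g \<Rightarrow> 'g"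
  aff_lie :: "'g \<Rightarrow> 'g \<Rightarrow> 'g"

definition lie_affgebra ::
  "('k::field \<Rightarrow> 'g::ab_group_add \<Rightarrow> 'g) \<Rightarrow> ('g \<Rightarrow> 'g \<Rightarrow> 'g) \<Rightarrow>
    ('g \<Rightarrow> 'g) \<Rightarrow> ('g \<Rightarrow> 'g) \<Rightarrow> 'g \<Rightarrow> ('k, 'g) affgebra" where
  "lie_affgebra scale lie \<kappa> lam s =
    \<lparr>tern = (\<lambda>a b c. a - b + c),
     act = (\<lambda>\<alpha> a b. scale (1 - \<alpha>) a + scale \<alpha> b),
     aff_lie = (\<lambda>a b. lie a b + \<kappa> a + lam (b - a) + s)\<rparr>"

definition center :: "('k, 'g) affgebra \<Rightarrow> 'g set" where
  "center A = {b. \<forall>a. aff_lie A a b = aff_lie A b a}"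

definition affine_subspace :: "('k, 'g) affgebra \<Rightarrow> 'g set \<Rightarrow> bool" where
  "affine_subspace A B \<longleftrightarrow>
    B \<noteq> {} \<and>
    (\<forall>a\<in>B. \<forall>b\<in>B. \<forall>c\<in>B. tern A a b c \<in> B) \<and>
    (\<forall>\<alpha>. \<forall>a\<in>B. \<forall>b\<in>B. act A \<alpha> a b \<in> B)"

definition ideaf :: "('k, 'g) affgebra \<Rightarrow> 'g set \<Rightarrow> bool" where
  "ideaf A B \<longleftrightarrow>
    affine_subspace A B \<and> (\<forall>a. \<forall>b\<in>B. aff_lie A a b \<in> B \<and> aff_lie A b a \<in> B)"

end

theory Submission
  imports Defs
begin

text \<open>
  For \<open>\<kappa> = 2\<lambda>\<close> the bracket is $\{a,b\} = [a,b] + \lambda(a+b) + s$, whose only non-symmetric part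
  is $[a,b]$. As $2$ is invertible, the center of the affgebra is therefore the center of the Lie
  algebra, a linear subspace. It contains \<open>s\<close> and the image of \<open>\<lambda>\<close>, hence also
  $\{a,b\} = \{b,a\} = \lambda(a+b) + s$ whenever \<open>b\<close> is central.
\<close>

text \<open>If 2 vanished, the characteristic would divide 2, and it cannot be 1 in a field.\<close>

lemma two_neq_zero_if_CHAR_neq_2:
  assumes "CHAR('k::field) \<noteq> 2"
  shows "(2::'k) \<noteq> 0"
proof
  assume "(2::'k) = 0"
  then have "CHAR('k) dvd 2"
    using of_nat_eq_0_iff_char_dvd[of 2, where 'a = 'k] by simp
  then have "CHAR('k) = 1 \<or> CHAR('k) = 2"
    by (cases "CHAR('k) = 0") (auto dest!: dvd_imp_le simp: le_Suc_eq numeral_2_eq_2)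
  with assms show False
    using CHAR_not_1[where 'a = 'k] by auto
qed

context lie_algebra
begin

lemma lie_module_hom_right: "module_hom scale scale (\<lambda>y. lie x y)"
  using lie_linear_right by (rule linear_iff_module_hom[THEN iffD1])

lemmas lie_add_right = module_hom.add[OF lie_module_hom_right]
  and lie_diff_right = module_hom.diff[OF lie_module_hom_right]
  and lie_scale_right = module_hom.scale[OF lie_module_hom_right]
  and lie_zero_right = module_hom.zero[OF lie_module_hom_right]

lemma lie_add_left: "lie (x + y) z = lie x z + lie y z"
  using module_hom.add[OF linear_iff_module_hom[THEN iffD1, OF lie_linear_left[of z]]] .

text \<open>Polarization: expand the vanishing square of \<open>x + y\<close>.\<close>

lemma lie_anticommute: "lie y x = - lie x y"
proof -
  have "lie x y + lie y x = lie (x + y) (x + y)"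
    unfolding lie_add_left lie_add_right by (simp add: lie_alternating)
  then have "lie x y + lie y x = 0"
    by (simp only: lie_alternating)
  then show ?thesis
    by (simp add: add_eq_0_iff)
qed

text \<open>By anticommutativity, commuting means that twice the bracket is zero; this is where 2
  has to be invertible.\<close>

lemma lie_commute_iff:
  assumes "(2::'k) \<noteq> 0"
  shows "lie x y = lie y x \<longleftrightarrow> lie x y = 0"
proof -
  have "lie x y = lie y x \<longleftrightarrow> lie x y + lie x y = 0"
    by (simp add: lie_anticommute[of y x] eq_neg_iff_add_eq_0)
  also have "lie x y + lie x y = scale 2 (lie x y)"
    using scale_left_distrib[of 1 1 "lie x y"] by simp
  finally show ?thesis
    using assms by simp
qed

end

context lie_affgebra_data
begin

lemma lam_module_hom: "module_hom scale scale lam"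
  using lam_linear by (rule linear_iff_module_hom[THEN iffD1])

text \<open>One of the two copies of \<open>lam a\<close> in \<open>\<kappa> a\<close> cancels
  against \<open>lam (b - a)\<close>, leaving a term symmetric in \<open>a\<close> and
  \<open>b\<close>.\<close>

lemma aff_lie_double:
  assumes "\<kappa> = (\<lambda>x. scale 2 (lam x))"
  shows "aff_lie (lie_affgebra scale lie \<kappa> lam s) a b = lie a b + lam (a + b) + s"
proof -
  have "scale 2 (lam a) = lam a + lam a"
    using scale_left_distrib[of 1 1 "lam a"] by simp
  then show ?thesis
    by (simp add: lie_affgebra_def assms module_hom.add[OF lam_module_hom]
        module_hom.diff[OF lam_module_hom])
qed

lemma center_double:
  assumes "(2::'k) \<noteq> 0" and "\<kappa> = (\<lambda>x. scale 2 (lam x))"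
  shows "center (lie_affgebra scale lie \<kappa> lam s) = {b. \<forall>a. lie a b = 0}"
  unfolding center_def aff_lie_double[OF assms(2)]
  by (simp add: add.commute[of _ "_ :: 'g"] lie_commute_iff[OF assms(1)])

end

theorem theorem4p2:
  fixes scale :: "'k::field \<Rightarrow> 'g::ab_group_add \<Rightarrow> 'g"
    and lie :: "'g \<Rightarrow> 'g \<Rightarrow> 'g"
    and \<kappa> lam :: "'g \<Rightarrow> 'g" and s :: 'g
  assumes "CHAR('k) \<noteq> 2"
    and "lie_affgebra_data scale lie \<kappa> lam"
    and "\<kappa> = (\<lambda>x. scale 2 (lam x))"
    and "\<And>x y. lie x (lam y) = 0"
    and "ad lie s = (\<lambda>x. 0)"
  shows "ideaf (lie_affgebra scale lie \<kappa> lam s) (center (lie_affgebra scale lie \<kappa> lam s))"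
proof -
  interpret lie_affgebra_data scale lie \<kappa> lam by fact
  let ?A = "lie_affgebra scale lie \<kappa> lam s"
  let ?Z = "{b. \<forall>a. lie a b = 0}"
  have Z: "center ?A = ?Z"
    using center_double[OF two_neq_zero_if_CHAR_neq_2[OF assms(1)] assms(3)] .
  \<comment> \<open>The hypothesis puts \<open>s\<close> in the left slot; anticommutativity moves
    it to the right slot, where \<open>?Z\<close> tests membership.\<close>
  have s: "lie x s = 0" for x
    using fun_cong[OF assms(5), of x] lie_anticommute[of x s] by (simp add: ad_def)
  \<comment> \<open>Closure is linearity in the right slot, and 0 witnesses non-emptiness.\<close>
  have "affine_subspace ?A ?Z"
    unfolding affine_subspace_def
    by (auto simp: lie_affgebra_def lie_add_right lie_diff_right lie_scale_right
        intro: lie_zero_right)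
  moreover have "aff_lie ?A a b \<in> ?Z \<and> aff_lie ?A b a \<in> ?Z" if "b \<in> ?Z" for a b
  proof -
    \<comment> \<open>With both Lie terms gone, either order of the affine bracket is a value of
      \<open>lam\<close> plus \<open>s\<close>.\<close>
    have "lie a b = 0" "lie b a = 0"
      using that lie_anticommute[of b a] by simp_all
    then show ?thesis
      by (simp add: aff_lie_double[OF assms(3)] lie_add_right assms(4) s)
  qed
  ultimately show ?thesis
    unfolding ideaf_def Z by blast
qed

end
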